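(* For every integer $n$, the $n$th Tribonacci sedenion satisfies $$\widehat{T}_n=\frac{\big((\alpha^2-\alpha)\widehat{T}_0+\alpha\widehat{T}_1+\widehat{T}_{-1}\big)\alpha^n}{(\alpha-\gamma)(\alpha-\beta)}+\frac{\big((\beta^2-\beta)\widehat{T}_0+\beta\widehat{T}_1+\widehat{T}_{-1}\big)\beta^n}{(\beta-\gamma)(\beta-\alpha)}+\frac{\big((\gamma^2-\gamma)\widehat{T}_0+\gamma\widehat{T}_1+\widehat{T}_{-1}\big)\gamma^n}{(\gamma-\beta)(\gamma-\alpha)},$$ and the $n$th Tribonacci-Lucas sedenion satisfies $$\widehat{K}_n=\frac{\big((\alpha^2-\alpha)\widehat{K}_0+\alpha\widehat{K}_1+\widehat{K}_{-1}\big)\alpha^n}{(\alpha-\gamma)(\alpha-\beta)}+\frac{\big((\beta^2-\beta)\widehat{K}_0+\beta\widehat{K}_1+\widehat{K}_{-1}\big)\beta^n}{(\beta-\gamma)(\beta-\alpha)}+\frac{\big((\gamma^2-\gamma)\widehat{K}_0+\gamma\widehat{K}_1+\widehat{K}_{-1}\big)\gamma^n}{(\gamma-\beta)(\gamma-\alpha)}.$$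
   Context: The Tribonacci numbers are $T_n=T_{n-1}+T_{n-2}+T_{n-3}$ with $T_0=0,T_1=1,T_2=1$, and the Tribonacci-Lucas numbers are $K_n=K_{n-1}+K_{n-2}+K_{n-3}$ with $K_0=3,K_1=1,K_2=3$; both are extended to negative indices so that the recurrences hold for all integers $n$. The sedenions $\mathbb{S}$ are the 16-dimensional real Cayley-Dickson algebra (the double of the octonions) with standard basis $e_0,e_1,\dots,e_{15}$, $e_0=1$ the identity; addition and multiplication by scalars are componentwise. For every integer $n$, $\widehat{T}_n=\sum_{s=0}^{15}T_{n+s}e_s$ and $\widehat{K}_n=\sum_{s=0}^{15}K_{n+s}e_s$. The numbers $\alpha,\beta,\gamma\in\mathbb{C}$ are the three (distinct) roots of $x^3-x^2-x-1=0$. Since $\beta,\gamma$ are non-real, expressions with complex coefficients are taken in the complexification $\mathbb{S}\otimes_{\mathbb{R}}\mathbb{C}$, in which $\mathbb{S}$ is embedded and complex scalars are central. *)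

theory Defs
  imports Complex_Main
begin

section \<open>Tribonacci and Tribonacci-Lucas numbers\<close>

text \<open>
  For negative indices the recurrence is read backwards,
  \<open>x\<^sub>n = x\<^bsub>n+3\<^esub> - x\<^bsub>n+2\<^esub> - x\<^bsub>n+1\<^esub>\<close>; this is the only extension to all integers for
  which the recurrence still holds.
\<close>

function gen_tribonacci :: "int \<Rightarrow> int \<Rightarrow> int \<Rightarrow> int \<Rightarrow> int" where
  "gen_tribonacci a b c n =
     (if n = 0 then a else if n = 1 then b else if n = 2 then c
      else if n > 2 then
        gen_tribonacci a b c (n - 1) + gen_tribonacci a b c (n - 2) + gen_tribonacci a b c (n - 3)
      else
        gen_tribonacci a b c (n + 3) - gen_tribonacci a b c (n + 2) - gen_tribonacci a b c (n + 1))"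
  by auto
termination
  by (relation "measure (\<lambda>(a, b, c, n). nat (if n < 0 then 2 - n else n))") auto

declare gen_tribonacci.simps [simp del]

definition tribonacci :: "int \<Rightarrow> int" where
  "tribonacci = gen_tribonacci 0 1 1"

definition tribonacci_lucas :: "int \<Rightarrow> int" where
  "tribonacci_lucas = gen_tribonacci 3 1 3"

lemma gen_tribonacci_init:
  "gen_tribonacci a b c 0 = a" "gen_tribonacci a b c 1 = b" "gen_tribonacci a b c 2 = c"
  by (simp_all add: gen_tribonacci.simps)

lemma gen_tribonacci_rec:
  "gen_tribonacci a b c n =
     gen_tribonacci a b c (n - 1) + gen_tribonacci a b c (n - 2) + gen_tribonacci a b c (n - 3)"
proof (cases "n > 2")
  case True
  then show ?thesis by (subst gen_tribonacci.simps) simp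
next
  case False
  then have "gen_tribonacci a b c (n - 3) =
      gen_tribonacci a b c n - gen_tribonacci a b c (n - 1) - gen_tribonacci a b c (n - 2)"
    by (subst gen_tribonacci.simps) (simp add: algebra_simps)
  then show ?thesis by simp
qed

lemma tribonacci:
  "tribonacci 0 = 0" "tribonacci 1 = 1" "tribonacci 2 = 1"
  "tribonacci n = tribonacci (n - 1) + tribonacci (n - 2) + tribonacci (n - 3)"
  unfolding tribonacci_def by (rule gen_tribonacci_init gen_tribonacci_rec)+

lemma tribonacci_lucas:
  "tribonacci_lucas 0 = 3" "tribonacci_lucas 1 = 1" "tribonacci_lucas 2 = 3"
  "tribonacci_lucas n = tribonacci_lucas (n - 1) + tribonacci_lucas (n - 2) + tribonacci_lucas (n - 3)"
  unfolding tribonacci_lucas_def by (rule gen_tribonacci_init gen_tribonacci_rec)+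


section \<open>Cayley-Dickson algebras and the sedenions\<close>

text \<open>
  Unital real algebras with involution, neither commutative nor associative in general, so the
  library's classes of real algebras do not apply. The class also carries the
  standard basis, of which only \<open>cd_basis s\<close> with \<open>s < cd_dim TYPE('a)\<close> is meaningful.
\<close>

class cd_algebra = real_vector + times + one +
  fixes cd_conj :: "'a \<Rightarrow> 'a"
    and cd_dim :: "'a itself \<Rightarrow> nat"
    and cd_basis :: "nat \<Rightarrow> 'a"
  assumes cd_mult_add_left: "(x + y) * z = x * z + y * z"
    and cd_mult_add_right: "z * (x + y) = z * x + z * y"
    and cd_mult_scaleR_left: "(r *\<^sub>R x) * y = r *\<^sub>R (x * y)"
    and cd_mult_scaleR_right: "x * (r *\<^sub>R y) = r *\<^sub>R (x * y)"
    and cd_mult_1_left: "1 * x = x"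
    and cd_mult_1_right: "x * 1 = x"
    and cd_conj_add: "cd_conj (x + y) = cd_conj x + cd_conj y"
    and cd_conj_scaleR: "cd_conj (r *\<^sub>R x) = r *\<^sub>R cd_conj x"
    and cd_conj_mult: "cd_conj (x * y) = cd_conj y * cd_conj x"
    and cd_conj_conj: "cd_conj (cd_conj x) = x"
    and cd_conj_1: "cd_conj 1 = 1"
    and cd_dim_pos: "cd_dim TYPE('a) > 0"
    and cd_basis_0: "cd_basis 0 = 1"
begin

lemma cd_conj_0: "cd_conj 0 = 0"
  using cd_conj_add[of 0 0] by simp

lemma cd_conj_minus: "cd_conj (- x) = - cd_conj x"
  using cd_conj_add[of x "- x"] by (simp add: cd_conj_0 eq_neg_iff_add_eq_0 add.commute)

lemma cd_conj_diff: "cd_conj (x - y) = cd_conj x - cd_conj y"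
  using cd_conj_add[of x "- y"] by (simp add: cd_conj_minus)

lemma cd_mult_0_left: "0 * x = 0"
  using cd_mult_add_left[of 0 0 x] by simp

lemma cd_mult_0_right: "x * 0 = 0"
  using cd_mult_add_right[of x 0 0] by simp

lemma cd_mult_minus_left: "(- x) * y = - (x * y)"
  using cd_mult_add_left[of x "- x" y]
  by (simp add: cd_mult_0_left eq_neg_iff_add_eq_0 add.commute)

lemma cd_mult_minus_right: "x * (- y) = - (x * y)"
  using cd_mult_add_right[of x y "- y"]
  by (simp add: cd_mult_0_right eq_neg_iff_add_eq_0 add.commute)

lemma cd_mult_diff_left: "(x - y) * z = x * z - y * z"
  using cd_mult_add_left[of x "- y" z] by (simp add: cd_mult_minus_left)

lemma cd_mult_diff_right: "z * (x - y) = z * x - z * y"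
  using cd_mult_add_right[of z x "- y"] by (simp add: cd_mult_minus_right)

lemmas cd_algebra_simps =
  cd_mult_add_left cd_mult_add_right cd_mult_diff_left cd_mult_diff_right
  cd_mult_minus_left cd_mult_minus_right cd_mult_0_left cd_mult_0_right
  cd_mult_scaleR_left cd_mult_scaleR_right cd_mult_1_left cd_mult_1_right
  cd_conj_add cd_conj_diff cd_conj_minus cd_conj_0 cd_conj_scaleR cd_conj_mult
  cd_conj_conj cd_conj_1

end

instantiation real :: cd_algebra
begin

definition "cd_conj (x::real) = x"
definition "cd_dim (_ :: real itself) = 1"
definition "cd_basis (s::nat) = (if s = 0 then 1 else 0 :: real)"

instance
  by standard (simp_all add: cd_conj_real_def cd_dim_real_def cd_basis_real_def algebra_simps)

end

datatype 'a cd = CD (cd_fst: 'a) (cd_snd: 'a)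

instantiation cd :: (real_vector) real_vector
begin

definition "0 = CD 0 0"
definition "x + y = CD (cd_fst x + cd_fst y) (cd_snd x + cd_snd y)"
definition "x - y = CD (cd_fst x - cd_fst y) (cd_snd x - cd_snd y)"
definition "- x = CD (- cd_fst x) (- cd_snd x)"
definition "r *\<^sub>R x = CD (r *\<^sub>R cd_fst x) (r *\<^sub>R cd_snd x)"

instance
  by standard
    (auto simp: zero_cd_def plus_cd_def minus_cd_def uminus_cd_def scaleR_cd_def
      scaleR_add_left scaleR_add_right algebra_simps split: cd.splits intro: cd.expand)

end

instantiation cd :: (cd_algebra) cd_algebra
begin

text \<open>
  The product is \<open>(a, b)(c, d) = (a c - d\<^sup>* b, d a + b c\<^sup>*)\<close> and the involution is
  \<open>(a, b)\<^sup>* = (a\<^sup>*, - b)\<close>. If \<open>e\<^sub>0, \<dots>, e\<^bsub>d-1\<^esub>\<close> is the basis of the original algebra, that of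
  its double is \<open>(e\<^sub>0, 0), \<dots>, (e\<^bsub>d-1\<^esub>, 0), (0, e\<^sub>0), \<dots>, (0, e\<^bsub>d-1\<^esub>)\<close>.
\<close>

definition "1 = CD 1 0"
definition "x * y =
  CD (cd_fst x * cd_fst y - cd_conj (cd_snd y) * cd_snd x)
     (cd_snd y * cd_fst x + cd_snd x * cd_conj (cd_fst y))"
definition "cd_conj x = CD (cd_conj (cd_fst x)) (- cd_snd x)"
definition "cd_dim (_ :: 'a cd itself) = 2 * cd_dim TYPE('a)"
definition "cd_basis s =
  (if s < cd_dim TYPE('a) then CD (cd_basis s) 0 else CD 0 (cd_basis (s - cd_dim TYPE('a))))"

instance
  by standard
    (simp_all add: cd_dim_pos cd_basis_0 one_cd_def zero_cd_def plus_cd_def scaleR_cd_def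
      times_cd_def cd_conj_cd_def cd_dim_cd_def cd_basis_cd_def cd_algebra_simps
      scaleR_add_right scaleR_diff_right)

end

text \<open>Complex numbers, quaternions, octonions and sedenions arise from the reals by one, two, three and
  four doublings.\<close>

type_synonym sedenion = "real cd cd cd cd"

lemma cd_dim_sedenion: "cd_dim TYPE(sedenion) = 16"
  by (simp add: cd_dim_cd_def cd_dim_real_def)

definition tribonacci_sedenion :: "int \<Rightarrow> sedenion" where
  "tribonacci_sedenion n = (\<Sum>s = 0..15. real_of_int (tribonacci (n + int s)) *\<^sub>R cd_basis s)"

definition tribonacci_lucas_sedenion :: "int \<Rightarrow> sedenion" where
  "tribonacci_lucas_sedenion n =
     (\<Sum>s = 0..15. real_of_int (tribonacci_lucas (n + int s)) *\<^sub>R cd_basis s)"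


section \<open>Complexification\<close>

text \<open>
  \<open>Cplx x y\<close> stands for \<open>x \<otimes> 1 + y \<otimes> \<i>\<close> in the tensor product of \<open>'a\<close> with the
  complex numbers over the reals; \<open>\<i>\<close> here is the complex scalar and not an element of \<open>'a\<close>.
  The multiplication is the complex-bilinear extension of that of \<open>'a\<close>.
\<close>

datatype 'a complexification = Cplx (re_part: 'a) (im_part: 'a)

instantiation complexification :: (ab_group_add) ab_group_add
begin

definition "0 = Cplx 0 0"
definition "x + y = Cplx (re_part x + re_part y) (im_part x + im_part y)"
definition "x - y = Cplx (re_part x - re_part y) (im_part x - im_part y)"
definition "- x = Cplx (- re_part x) (- im_part x)"

instance
  by standard
    (auto simp: zero_complexification_def plus_complexification_def minus_complexification_def
      uminus_complexification_def algebra_simps intro: complexification.expand)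

end

instantiation complexification :: (cd_algebra) times
begin

definition "x * y =
  Cplx (re_part x * re_part y - im_part x * im_part y)
       (re_part x * im_part y + im_part x * re_part y)"

instance ..

end

definition scaleC :: "complex \<Rightarrow> 'a::real_vector complexification \<Rightarrow> 'a complexification"
    (infixr "*\<^sub>C" 75) where
  "c *\<^sub>C x = Cplx (Re c *\<^sub>R re_part x - Im c *\<^sub>R im_part x)
                   (Re c *\<^sub>R im_part x + Im c *\<^sub>R re_part x)"

definition complexify :: "'a::real_vector \<Rightarrow> 'a complexification" where
  "complexify x = Cplx x 0"

interpretation complexification: vector_space "scaleC"
  by standard
    (simp_all add: scaleC_def plus_complexification_def scaleR_add_left scaleR_add_right
      scaleR_diff_left scaleR_diff_right algebra_simps)

lemma inj_complexify: "inj complexify"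
  by (auto simp: inj_def complexify_def)

lemma complexify_add: "complexify (x + y) = complexify x + complexify y"
  by (simp add: complexify_def plus_complexification_def)

lemma complexify_scaleR: "complexify (r *\<^sub>R x) = complex_of_real r *\<^sub>C complexify x"
  by (simp add: complexify_def scaleC_def)

lemma complexify_mult: "complexify (x * y) = complexify x * complexify y"
  for x y :: "'a::cd_algebra"
  by (simp add: complexify_def times_complexification_def cd_algebra_simps)

lemma Cplx_eq: "Cplx x y = complexify x + \<i> *\<^sub>C complexify y"
  by (simp add: complexify_def scaleC_def plus_complexification_def)

lemma scaleC_mult:
  fixes x y :: "'a::cd_algebra complexification"
  shows "(c *\<^sub>C x) * y = c *\<^sub>C (x * y)" "x * (c *\<^sub>C y) = c *\<^sub>C (x * y)"
  by (simp_all add: scaleC_def times_complexification_def cd_algebra_simps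
      scaleR_add_right scaleR_diff_right algebra_simps)

end

theory Submission
  imports Defs
begin

text \<open>
  A two-sided solution of the recurrence \<open>x\<^sub>n = x\<^bsub>n-1\<^esub> + x\<^bsub>n-2\<^esub> + x\<^bsub>n-3\<^esub>\<close>, with values in any
  abelian group, is determined by three consecutive terms. Both sides of Binet's formula are
  such solutions: the left because sedenions are combined componentwise, the right because
  \<open>\<rho>\<^sup>n\<close> solves the recurrence for each root \<open>\<rho>\<close> of \<open>x\<^sup>3 - x\<^sup>2 - x - 1\<close>. So it is enough to
  compare them at the indices \<open>-1\<close>, \<open>0\<close> and \<open>1\<close>.

  For this comparison, let \<open>h\<^sub>n\<close> be the sum of \<open>\<rho>\<^sup>n / \<Prod>(\<rho> - \<sigma>)\<close> over the roots \<open>\<rho>\<close>, the product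
  running over the two other roots \<open>\<sigma>\<close>. This is the second divided difference of \<open>x\<^sup>n\<close> at the
  roots, so \<open>h\<^sub>0 = h\<^sub>1 = 0\<close> and \<open>h\<^sub>2 = 1\<close> (\<open>divided_difference_power\<close>), and the recurrence gives
  \<open>h\<^bsub>-1\<^esub> = h\<^sub>3 = 1\<close>. The right-hand side, collected by initial values, is
  \<open>(h\<^bsub>n+2\<^esub> - h\<^bsub>n+1\<^esub>) X\<^sub>0 + h\<^bsub>n+1\<^esub> X\<^sub>1 + h\<^sub>n X\<^bsub>-1\<^esub>\<close>, which takes the values \<open>X\<^bsub>-1\<^esub>\<close>, \<open>X\<^sub>0\<close>, \<open>X\<^sub>1\<close> at the
  three indices.
\<close>

definition tribonacci_like :: "(int \<Rightarrow> 'a::ab_group_add) \<Rightarrow> bool" where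
  "tribonacci_like x \<longleftrightarrow> (\<forall>n. x n = x (n - 1) + x (n - 2) + x (n - 3))"

lemma tribonacci_likeD:
  "tribonacci_like x \<Longrightarrow> x n = x (n - 1) + x (n - 2) + x (n - 3)"
  unfolding tribonacci_like_def by blast

text \<open>A window of three consecutive agreements moves one step up by the recurrence, and one step
  down by the recurrence solved for its last term.\<close>

lemma tribonacci_like_unique:
  assumes x: "tribonacci_like x" and y: "tribonacci_like y"
    and init: "x (- 1) = y (- 1)" "x 0 = y 0" "x 1 = y 1"
  shows "x n = y n"
proof -
  have "x n = y n \<and> x (n + 1) = y (n + 1) \<and> x (n + 2) = y (n + 2)"
  proof (induction n rule: int_induct[where k = "-1"])
    case base
    show ?case using init by simp
  next
    case (step1 i)
    then show ?case
      using tribonacci_likeD[OF x, of "i + 3"] tribonacci_likeD[OF y, of "i + 3"]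
      by (simp add: algebra_simps)
  next
    case (step2 i)
    have "z (i - 1) = z (i + 2) - z (i + 1) - z i" if "tribonacci_like z" for z :: "int \<Rightarrow> 'a"
      using tribonacci_likeD[OF that, of "i + 2"] by (simp add: add.commute[of i 1])
    from this[OF x] this[OF y] step2 show ?case
      by (simp add: add.commute[of i 1])
  qed
  then show ?thesis by blast
qed

lemma tribonacci_like_add:
  "tribonacci_like x \<Longrightarrow> tribonacci_like y \<Longrightarrow> tribonacci_like (\<lambda>n. x n + y n)"
  unfolding tribonacci_like_def
proof
  fix n
  assume "\<forall>n. x n = x (n - 1) + x (n - 2) + x (n - 3)"
    "\<forall>n. y n = y (n - 1) + y (n - 2) + y (n - 3)"
  then have "x n + y n = (x (n - 1) + x (n - 2) + x (n - 3)) + (y (n - 1) + y (n - 2) + y (n - 3))"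
    by metis
  then show "x n + y n = (x (n - 1) + y (n - 1)) + (x (n - 2) + y (n - 2)) + (x (n - 3) + y (n - 3))"
    by (simp only: add_ac)
qed

lemma tribonacci_like_powi:
  fixes \<rho> :: "'a::field"
  assumes "\<rho> ^ 3 - \<rho> ^ 2 - \<rho> - 1 = 0"
  shows "tribonacci_like (\<lambda>n. \<rho> powi n)"
proof -
  have nz: "\<rho> \<noteq> 0" using assms by auto
  have cubic: "\<rho> ^ 3 = \<rho> ^ 2 + \<rho> + 1"
    using assms by (simp add: algebra_simps)
  have "\<rho> powi n = \<rho> powi (n - 1) + \<rho> powi (n - 2) + \<rho> powi (n - 3)" for n
  proof -
    have shift: "\<rho> powi (n - 3) * \<rho> ^ k = \<rho> powi (n - 3 + int k)" for k
      using nz by (simp add: power_int_add)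
    have "\<rho> powi (n - 3) * \<rho> ^ 3 = \<rho> powi (n - 3) * (\<rho> ^ 2 + \<rho> ^ 1 + \<rho> ^ 0)"
      unfolding cubic by simp
    then show ?thesis
      unfolding distrib_left shift by simp
  qed
  then show ?thesis unfolding tribonacci_like_def by blast
qed

text \<open>Applied below to division by a constant, to \<open>c \<mapsto> (c / d) *\<^sub>C u\<close> and to \<open>complexify\<close>.\<close>

lemma tribonacci_like_additive:
  assumes "tribonacci_like x" and "\<And>u v. f (u + v) = f u + f v"
  shows "tribonacci_like (\<lambda>n. f (x n))"
  unfolding tribonacci_like_def
proof
  fix n
  show "f (x n) = f (x (n - 1)) + f (x (n - 2)) + f (x (n - 3))"
    unfolding tribonacci_likeD[OF assms(1), of n] assms(2) ..
qed

text \<open>The sums are the second divided differences of \<open>1\<close>, \<open>x\<close> and \<open>x\<^sup>2\<close> at three points: these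
  vanish below degree two and give the leading coefficient in degree two.\<close>

lemma divided_difference_power:
  fixes a b c :: "'a::field"
  assumes "a \<noteq> b" "a \<noteq> c" "b \<noteq> c"
  shows "1 / ((a - c) * (a - b)) + 1 / ((b - c) * (b - a)) + 1 / ((c - b) * (c - a)) = 0"
    and "a / ((a - c) * (a - b)) + b / ((b - c) * (b - a)) + c / ((c - b) * (c - a)) = 0"
    and "a\<^sup>2 / ((a - c) * (a - b)) + b\<^sup>2 / ((b - c) * (b - a)) + c\<^sup>2 / ((c - b) * (c - a)) = 1"
proof -
  have nz: "a - b \<noteq> 0" "a - c \<noteq> 0" "b - c \<noteq> 0"
    using assms by auto
  have orient: "(b - c) * (b - a) = - ((a - b) * (b - c))" "(c - b) * (c - a) = (a - c) * (b - c)"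
    by (simp_all add: algebra_simps)
  have common: "p / ((a - c) * (a - b)) + q / ((b - c) * (b - a)) + r / ((c - b) * (c - a)) =
      (p * (b - c) - q * (a - c) + r * (a - b)) / ((a - b) * (a - c) * (b - c))" for p q r
  proof -
    have "p / ((a - c) * (a - b)) = p * (b - c) / ((a - b) * (a - c) * (b - c))"
      "q / - ((a - b) * (b - c)) = - (q * (a - c) / ((a - b) * (a - c) * (b - c)))"
      "r / ((a - c) * (b - c)) = r * (a - b) / ((a - b) * (a - c) * (b - c))"
      using nz by simp_all
    then show ?thesis
      unfolding orient by (simp only: add_divide_distrib diff_divide_distrib)
        (simp only: diff_conv_add_uminus)
  qed
  show "1 / ((a - c) * (a - b)) + 1 / ((b - c) * (b - a)) + 1 / ((c - b) * (c - a)) = 0"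
    "a / ((a - c) * (a - b)) + b / ((b - c) * (b - a)) + c / ((c - b) * (c - a)) = 0"
    unfolding common by (simp_all add: algebra_simps)
  have "a\<^sup>2 * (b - c) - b\<^sup>2 * (a - c) + c\<^sup>2 * (a - b) = (a - b) * (a - c) * (b - c)"
    by (simp add: algebra_simps power2_eq_square)
  then show "a\<^sup>2 / ((a - c) * (a - b)) + b\<^sup>2 / ((b - c) * (b - a)) + c\<^sup>2 / ((c - b) * (c - a)) = 1"
    unfolding common using nz by simp
qed

text \<open>The coefficient at the root \<open>\<alpha>\<close> is the usual \<open>X\<^sub>2 - (\<beta> + \<gamma>) X\<^sub>1 + \<beta>\<gamma> X\<^sub>0\<close>, rewritten with
  \<open>\<beta> + \<gamma> = 1 - \<alpha>\<close>, \<open>\<beta>\<gamma> = \<alpha>\<^sup>2 - \<alpha> - 1\<close> and \<open>X\<^sub>2 = X\<^sub>1 + X\<^sub>0 + X\<^bsub>-1\<^esub>\<close>; the last substitution is why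
  the initial values are taken at \<open>-1\<close>, \<open>0\<close> and \<open>1\<close>.\<close>

lemma binet_formula:
  fixes X :: "int \<Rightarrow> 'a::real_vector complexification"
  assumes X: "tribonacci_like X"
    and roots: "\<alpha> ^ 3 - \<alpha> ^ 2 - \<alpha> - 1 = 0" "\<beta> ^ 3 - \<beta> ^ 2 - \<beta> - 1 = 0"
      "\<gamma> ^ 3 - \<gamma> ^ 2 - \<gamma> - 1 = 0"
    and distinct: "\<alpha> \<noteq> \<beta>" "\<alpha> \<noteq> \<gamma>" "\<beta> \<noteq> \<gamma>"
  shows "X n =
       (\<alpha> powi n / ((\<alpha> - \<gamma>) * (\<alpha> - \<beta>))) *\<^sub>C ((\<alpha>\<^sup>2 - \<alpha>) *\<^sub>C X 0 + \<alpha> *\<^sub>C X 1 + X (-1))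
     + (\<beta> powi n / ((\<beta> - \<gamma>) * (\<beta> - \<alpha>))) *\<^sub>C ((\<beta>\<^sup>2 - \<beta>) *\<^sub>C X 0 + \<beta> *\<^sub>C X 1 + X (-1))
     + (\<gamma> powi n / ((\<gamma> - \<beta>) * (\<gamma> - \<alpha>))) *\<^sub>C ((\<gamma>\<^sup>2 - \<gamma>) *\<^sub>C X 0 + \<gamma> *\<^sub>C X 1 + X (-1))"
    (is "_ = ?R n")
proof (rule tribonacci_like_unique[OF X, where y = ?R])
  have summand: "tribonacci_like (\<lambda>n. (\<rho> powi n / d) *\<^sub>C u)"
    if "\<rho> ^ 3 - \<rho> ^ 2 - \<rho> - 1 = 0" for \<rho> d and u :: "'a complexification"
    by (rule tribonacci_like_additive[OF tribonacci_like_powi[OF that]])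
      (simp add: add_divide_distrib complexification.scale_left_distrib)
  show "tribonacci_like ?R"
    by (intro tribonacci_like_add summand roots)

  define h where "h n = \<alpha> powi n / ((\<alpha> - \<gamma>) * (\<alpha> - \<beta>)) + \<beta> powi n / ((\<beta> - \<gamma>) * (\<beta> - \<alpha>))
    + \<gamma> powi n / ((\<gamma> - \<beta>) * (\<gamma> - \<alpha>))" for n
  have nz: "\<alpha> \<noteq> 0" "\<beta> \<noteq> 0" "\<gamma> \<noteq> 0"
    using roots by auto
  have shift: "\<rho> powi n * (\<rho>\<^sup>2 - \<rho>) = \<rho> powi (n + 2) - \<rho> powi (n + 1)"
    "\<rho> powi n * \<rho> = \<rho> powi (n + 1)" if "\<rho> \<noteq> 0" for \<rho> :: complex and n
    using that by (simp_all add: power_int_add algebra_simps)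
  have summand_R: "(\<rho> powi n / d) *\<^sub>C ((\<rho>\<^sup>2 - \<rho>) *\<^sub>C X 0 + \<rho> *\<^sub>C X 1 + X (-1)) =
      (\<rho> powi (n + 2) / d - \<rho> powi (n + 1) / d) *\<^sub>C X 0
        + (\<rho> powi (n + 1) / d) *\<^sub>C X 1 + (\<rho> powi n / d) *\<^sub>C X (-1)"
    if "\<rho> \<noteq> 0" for \<rho> d n
    using shift[OF that, of n]
    by (simp add: complexification.scale_right_distrib flip: diff_divide_distrib)
  have R: "?R n = (h (n + 2) - h (n + 1)) *\<^sub>C X 0 + h (n + 1) *\<^sub>C X 1 + h n *\<^sub>C X (-1)" for n
    unfolding nz[THEN summand_R] h_def
    by (simp add: complexification.scale_left_distrib complexification.scale_left_diff_distrib)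

  have h_init: "h 0 = 0" "h 1 = 0" "h 2 = 1"
    using divided_difference_power[OF distinct] by (simp_all add: h_def)
  have "tribonacci_like h"
  proof -
    have quotient: "tribonacci_like (\<lambda>n. \<rho> powi n / d)" if "\<rho> ^ 3 - \<rho> ^ 2 - \<rho> - 1 = 0" for \<rho> d :: complex
      by (rule tribonacci_like_additive[OF tribonacci_like_powi[OF that] add_divide_distrib])
    show ?thesis
      unfolding h_def by (intro tribonacci_like_add quotient roots)
  qed
  then have "h 3 = 1" "h (-1) = 1"
    using tribonacci_likeD[of h 3] tribonacci_likeD[of h 2] h_init by simp_all
  with h_init show "X (-1) = ?R (-1)" "X 0 = ?R 0" "X 1 = ?R 1"
    unfolding R by simp_all
qed

lemma tribonacci_like_complexify_sum:
  assumes "tribonacci_like t"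
  shows "tribonacci_like (\<lambda>n. complexify (\<Sum>s\<in>S. real_of_int (t (n + int s)) *\<^sub>R e s))"
proof -
  have t: "t (n + int s) = t (n - 1 + int s) + t (n - 2 + int s) + t (n - 3 + int s)" for n s
    using tribonacci_likeD[OF assms, of "n + int s"] by (simp add: algebra_simps)
  have "(\<Sum>s\<in>S. real_of_int (t (n + int s)) *\<^sub>R e s) =
      (\<Sum>s\<in>S. real_of_int (t (n - 1 + int s)) *\<^sub>R e s)
        + (\<Sum>s\<in>S. real_of_int (t (n - 2 + int s)) *\<^sub>R e s)
        + (\<Sum>s\<in>S. real_of_int (t (n - 3 + int s)) *\<^sub>R e s)" for n
    unfolding t[of n] by (simp add: scaleR_add_left sum.distrib)
  then have "tribonacci_like (\<lambda>n. \<Sum>s\<in>S. real_of_int (t (n + int s)) *\<^sub>R e s)"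
    unfolding tribonacci_like_def by blast
  then show ?thesis
    by (rule tribonacci_like_additive[OF _ complexify_add])
qed

lemma tribonacci_like_sedenions:
  "tribonacci_like (\<lambda>n. complexify (tribonacci_sedenion n))"
  "tribonacci_like (\<lambda>n. complexify (tribonacci_lucas_sedenion n))"
proof -
  have "tribonacci_like tribonacci" "tribonacci_like tribonacci_lucas"
    unfolding tribonacci_like_def using tribonacci(4) tribonacci_lucas(4) by blast+
  then show "tribonacci_like (\<lambda>n. complexify (tribonacci_sedenion n))"
    "tribonacci_like (\<lambda>n. complexify (tribonacci_lucas_sedenion n))"
    unfolding tribonacci_sedenion_def tribonacci_lucas_sedenion_def
    by (simp_all only: tribonacci_like_complexify_sum)
qed

theorem theorem2p4:
  fixes \<alpha> \<beta> \<gamma> :: complex and n :: int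
  assumes roots: "{x :: complex. x ^ 3 - x ^ 2 - x - 1 = 0} = {\<alpha>, \<beta>, \<gamma>}"
    and distinct: "\<alpha> \<noteq> \<beta>" "\<alpha> \<noteq> \<gamma>" "\<beta> \<noteq> \<gamma>"
  shows
    "complexify (tribonacci_sedenion n) =
       (\<alpha> powi n / ((\<alpha> - \<gamma>) * (\<alpha> - \<beta>))) *\<^sub>C
         ((\<alpha>\<^sup>2 - \<alpha>) *\<^sub>C complexify (tribonacci_sedenion 0)
           + \<alpha> *\<^sub>C complexify (tribonacci_sedenion 1)
           + complexify (tribonacci_sedenion (-1)))
     + (\<beta> powi n / ((\<beta> - \<gamma>) * (\<beta> - \<alpha>))) *\<^sub>C
         ((\<beta>\<^sup>2 - \<beta>) *\<^sub>C complexify (tribonacci_sedenion 0)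
           + \<beta> *\<^sub>C complexify (tribonacci_sedenion 1)
           + complexify (tribonacci_sedenion (-1)))
     + (\<gamma> powi n / ((\<gamma> - \<beta>) * (\<gamma> - \<alpha>))) *\<^sub>C
         ((\<gamma>\<^sup>2 - \<gamma>) *\<^sub>C complexify (tribonacci_sedenion 0)
           + \<gamma> *\<^sub>C complexify (tribonacci_sedenion 1)
           + complexify (tribonacci_sedenion (-1)))
   \<and> complexify (tribonacci_lucas_sedenion n) =
       (\<alpha> powi n / ((\<alpha> - \<gamma>) * (\<alpha> - \<beta>))) *\<^sub>C
         ((\<alpha>\<^sup>2 - \<alpha>) *\<^sub>C complexify (tribonacci_lucas_sedenion 0)
           + \<alpha> *\<^sub>C complexify (tribonacci_lucas_sedenion 1)
           + complexify (tribonacci_lucas_sedenion (-1)))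
     + (\<beta> powi n / ((\<beta> - \<gamma>) * (\<beta> - \<alpha>))) *\<^sub>C
         ((\<beta>\<^sup>2 - \<beta>) *\<^sub>C complexify (tribonacci_lucas_sedenion 0)
           + \<beta> *\<^sub>C complexify (tribonacci_lucas_sedenion 1)
           + complexify (tribonacci_lucas_sedenion (-1)))
     + (\<gamma> powi n / ((\<gamma> - \<beta>) * (\<gamma> - \<alpha>))) *\<^sub>C
         ((\<gamma>\<^sup>2 - \<gamma>) *\<^sub>C complexify (tribonacci_lucas_sedenion 0)
           + \<gamma> *\<^sub>C complexify (tribonacci_lucas_sedenion 1)
           + complexify (tribonacci_lucas_sedenion (-1)))"
proof -
  have "x ^ 3 - x ^ 2 - x - 1 = 0" if "x \<in> {\<alpha>, \<beta>, \<gamma>}" for x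
    using that roots by blast
  then have "\<alpha> ^ 3 - \<alpha> ^ 2 - \<alpha> - 1 = 0" "\<beta> ^ 3 - \<beta> ^ 2 - \<beta> - 1 = 0" "\<gamma> ^ 3 - \<gamma> ^ 2 - \<gamma> - 1 = 0"
    by blast+
  note binet = binet_formula[OF _ this distinct]
  show ?thesis
    by (intro conjI binet[OF tribonacci_like_sedenions(1)] binet[OF tribonacci_like_sedenions(2)])
qed

end
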